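(* Let $q=3^d$ with $d$ even, and let $\beta$ be a fixed primitive root of $\mathbb{F}_q^\times$ (a generator of the multiplicative group). Consider the elliptic curves $E\colon y^2=x^3-\beta x$ and $E'\colon y^2=x^3-\beta^3x$ over $\mathbb{F}_q$. Then $\#E(\mathbb{F}_q)=\#E'(\mathbb{F}_q)=q+1$.
   Context: $\#E(\mathbb{F}_q)$ counts all $\mathbb{F}_q$-rational points, including the point at infinity. *)

theory Defs
  imports "HOL-Computational_Algebra.Computational_Algebra" "HOL-Library.Cardinality"
begin

text \<open>Points of a plane cubic in Weierstrass form over \<open>'a\<close>: affine points together with the
  unique point \<open>(0 : 1 : 0)\<close> on the line at infinity.\<close>

datatype 'a ec_point = Infinity | Affine 'a 'a

definition weierstrass_points :: "'a::field \<Rightarrow> 'a \<Rightarrow> 'a ec_point set" where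
  "weierstrass_points a b =
     insert Infinity {Affine x y | x y. y ^ 2 = x ^ 3 + a * x + b}"

text \<open>The discriminant of \<open>y\<^sup>2 = x\<^sup>3 + a x + b\<close>; outside characteristic 2 the cubic is an
  elliptic curve iff it does not vanish.\<close>

definition weierstrass_disc :: "'a::field \<Rightarrow> 'a \<Rightarrow> 'a" where
  "weierstrass_disc a b = - 16 * (4 * a ^ 3 + 27 * b ^ 2)"

text \<open>The cyclic subgroup generated by \<open>\<beta>\<close> is the whole multiplicative group; the equation
  forces \<open>\<beta> \<noteq> 0\<close>, because \<open>0 powi 1 = 0\<close>.\<close>

definition primitive_root :: "'a::field \<Rightarrow> bool" where
  "primitive_root \<beta> \<longleftrightarrow> range (\<lambda>k::int. \<beta> powi k) = UNIV - {0}"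

lemma primitive_root_nonzero: "primitive_root \<beta> \<Longrightarrow> \<beta> \<noteq> 0"
proof
  assume *: "primitive_root \<beta>" "\<beta> = 0"
  have "\<beta> powi (1::int) \<in> UNIV - {0}"
    using *(1) unfolding primitive_root_def by blast
  with *(2) show False by simp
qed

text \<open>Hence \<open>y\<^sup>2 = x\<^sup>3 - c x\<close> is an elliptic curve in characteristic 3 for every \<open>c \<noteq> 0\<close>, in
  particular for \<open>c = \<beta>\<close> and \<open>c = \<beta>\<^sup>3\<close> with \<open>\<beta>\<close> a primitive root.\<close>

lemma weierstrass_disc_char_3:
  fixes c :: "'a::field"
  assumes "CHAR('a) = 3" and "c \<noteq> 0"
  shows "weierstrass_disc (- c) 0 \<noteq> 0"
proof -
  have "of_nat 3 = (0::'a)"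
    using assms(1) by (simp only: of_nat_eq_0_iff_char_dvd dvd_refl)
  then have three: "(3::'a) = 0" by simp
  have "(64::'a) = 21 * 3 + 1" by simp
  then have "(64::'a) = 1" by (simp only: three mult_zero_right add_0)
  moreover have "weierstrass_disc (- c) 0 = 64 * c ^ 3"
    by (simp add: weierstrass_disc_def)
  ultimately show ?thesis using assms(2) by simp
qed

end

theory Submission imports Defs "HOL-Number_Theory.Residues" begin

text \<open>In characteristic 3 the map \<open>x \<mapsto> x\<^sup>3 - c x\<close> is additive with kernel \<open>{x. x = 0 \<or> x\<^sup>2 = c}\<close>.
  When \<open>c\<close> is not a square it is therefore a bijection of the finite field, so every \<open>y\<close> is the
  second coordinate of exactly one affine point. Both \<open>\<beta>\<close> and \<open>\<beta>\<^sup>3\<close> are non-squares, because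
  squaring is not surjective in odd characteristic.\<close>

lemma card_weierstrass_points_char_3:
  fixes c :: "'a::{field, finite}"
  assumes char: "CHAR('a) = 3" and nonsquare: "\<And>s. s ^ 2 \<noteq> c"
  shows "card (weierstrass_points (- c) 0) = CARD('a) + 1"
proof -
  have three: "prime (3::nat)"
    by simp
  define f where "f x = x ^ 3 - c * x" for x
  have "inj f"
  proof (rule injI)
    fix x y assume "f x = f y"
    \<comment> \<open>Cubing is additive in characteristic 3; apply this to
      \<open>x = (x - y) + y\<close>.\<close>
    have "(x - y) ^ 3 = x ^ 3 - y ^ 3"
      by (metis char three diff_add_cancel add_diff_cancel_right' freshmans_dream)
    also have "\<dots> = c * (x - y)"
      using \<open>f x = f y\<close> by (simp add: f_def algebra_simps)
    finally have "(x - y) ^ 2 * (x - y) = c * (x - y)"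
      by (simp only: power3_eq_cube power2_eq_square)
    \<comment> \<open>If \<open>x - y\<close> were nonzero, cancelling it would make
      \<open>c\<close> the square of \<open>x - y\<close>.\<close>
    then show "x = y"
      by (simp only: mult_cancel_right nonsquare right_minus_eq simp_thms)
  qed
  then have "bij f"
    by (simp add: bij_def finite_UNIV_inj_surj)
  define g where "g = inv_into UNIV f"
  \<comment> \<open>The curve equation is solved for \<open>x\<close>, so \<open>y\<close> alone
    parametrizes the affine points; \<open>Infinity\<close> accounts for the
    \<open>+ 1\<close>.\<close>
  have "y ^ 2 = f x \<longleftrightarrow> x = g (y ^ 2)" for x y
    by (metis g_def \<open>bij f\<close> bij_inv_eq_iff)
  then have "weierstrass_points (- c) 0 = insert Infinity (range (\<lambda>y. Affine (g (y ^ 2)) y))"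
    by (auto simp: weierstrass_points_def f_def)
  moreover have "inj (\<lambda>y. Affine (g (y ^ 2)) y)"
    by (rule injI) simp
  ultimately show ?thesis
    by (simp add: card_image image_iff)
qed

text \<open>If the generator were a square, so would be all its powers, hence every element. On a
  finite field squaring would then also be injective, although \<open>1\<close> and
  \<open>- 1\<close> have the same square.\<close>

lemma primitive_root_not_square:
  fixes \<beta> s :: "'a::{field, finite}"
  assumes "primitive_root \<beta>" and "CHAR('a) \<noteq> 2"
  shows "s ^ 2 \<noteq> \<beta>"
proof
  assume s: "s ^ 2 = \<beta>"
  have "\<exists>t. x = t ^ 2" for x :: 'a
  proof (cases "x = 0")
    case False
    then obtain k :: int where "x = \<beta> powi k"
      using assms(1) unfolding primitive_root_def by blast
    also have "\<dots> = (s powi k) ^ 2"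
      by (simp add: power2_eq_square power_int_mult_distrib flip: s)
    finally show ?thesis ..
  qed (auto intro: exI[of _ 0])
  then have "surj (\<lambda>t::'a. t ^ 2)"
    unfolding surj_def by blast
  then have "inj (\<lambda>t::'a. t ^ 2)"
    by (rule finite_UNIV_surj_inj[OF finite])
  then have "(1::'a) = - 1"
    by (rule injD) simp
  then have "of_nat 2 = (0::'a)"
    by (simp add: eq_neg_iff_add_eq_0)
  then have "CHAR('a) dvd 2"
    by (simp only: of_nat_eq_0_iff_char_dvd)
  with assms(2) show False
    using two_is_prime_nat CHAR_not_1'[where 'a = 'a] by (auto simp: prime_nat_iff)
qed

theorem proposition3p5:
  fixes \<beta> :: "'a::{field, finite}" and d q :: nat
  assumes "q = 3 ^ d" and "even d"
    and "CARD('a) = q"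
    and "primitive_root \<beta>"
  shows "card (weierstrass_points (- \<beta>) 0) = q + 1
       \<and> card (weierstrass_points (- (\<beta> ^ 3)) 0) = q + 1"
proof -
  have "prime CHAR('a)"
    by (simp add: finite_imp_CHAR_pos prime_CHAR_semidom)
  moreover have "CHAR('a) dvd 3 ^ d"
    using CHAR_dvd_CARD[where 'a = 'a] assms(1,3) by simp
  moreover have "prime (3::nat)"
    by simp
  ultimately have char: "CHAR('a) = 3"
    by (blast dest: prime_dvd_power primes_dvd_imp_eq)
  then have nonsquare: "s ^ 2 \<noteq> \<beta>" for s
    by (intro primitive_root_not_square[OF assms(4)]) simp
  have "s ^ 2 \<noteq> \<beta> ^ 3" for s
  proof
    assume "s ^ 2 = \<beta> ^ 3"
    \<comment> \<open>Dividing by the square \<open>\<beta> ^ 2\<close> reduces the claim for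
      \<open>\<beta> ^ 3\<close> to that for \<open>\<beta>\<close>.\<close>
    then have "(s / \<beta>) ^ 2 = \<beta>"
      using primitive_root_nonzero[OF assms(4)]
      by (simp add: power_divide power2_eq_square power3_eq_cube)
    with nonsquare show False by blast
  qed
  with nonsquare show ?thesis
    using card_weierstrass_points_char_3[OF char] assms(3) by simp
qed

end
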